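(* For all $n\geq 0$, $\mathrm{st}(2n+1)+\mathrm{st}(4n+1)\equiv 0 \pmod 2$.
   Context: The semi-tribonacci sequence $\{\mathrm{st}(n)\}_{n\ge0}$ is defined recursively by $\mathrm{st}(0)=0$, $\mathrm{st}(1)=1$, and for $n\ge1$: $\mathrm{st}(2n)=\mathrm{st}(n)$ and $\mathrm{st}(2n+1)=\mathrm{st}(2n)+\mathrm{st}(2n-1)+\mathrm{st}(2n-2)$. *)

theory Defs
  imports "HOL-Number_Theory.Cong"
begin

text \<open>
  The semi-tribonacci sequence. The defining clauses in the form
  \<open>st (2 * n) = \<dots>\<close>, \<open>st (2 * n + 1) = \<dots>\<close> for \<open>n \<ge> 1\<close> are derived below; in the odd branch
  \<open>n \<ge> 3\<close>, so no subtraction is truncated.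
\<close>

fun st :: "nat \<Rightarrow> nat" where
  "st n =
    (if n = 0 then 0
     else if n = 1 then 1
     else if even n then st (n div 2)
     else st (n - 1) + st (n - 2) + st (n - 3))"

declare st.simps [simp del]

lemma st_0: "st 0 = 0"
  by (simp add: st.simps)

lemma st_1: "st 1 = 1"
  by (simp add: st.simps)

lemma st_even:
  assumes "n \<ge> 1"
  shows "st (2 * n) = st n"
  using assms by (subst st.simps) auto

lemma st_odd:
  assumes "n \<ge> 1"
  shows "st (2 * n + 1) = st (2 * n) + st (2 * n - 1) + st (2 * n - 2)"
proof -
  have "2 * n + 1 - 2 = 2 * n - 1" "2 * n + 1 - 3 = 2 * n - 2"
    by simp_all
  then show ?thesis
    using assms by (subst st.simps) simp
qed

end

theory Submission
  imports Defs
begin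

text \<open>
  Halving the even arguments in the recurrence gives
  \<open>st (2 * k + 1) - st (2 * k - 1) = st k + st (k - 1)\<close>. Summed over \<open>k\<close>, every term except the
  last occurs twice, so \<open>st (2 * k + 1)\<close> has the parity of \<open>1 + st k\<close>
  (\<open>st_odd_eq_partial_sum\<close>). The arguments \<open>2 * n + 1\<close> and \<open>4 * n + 1\<close> correspond to \<open>k = n\<close>
  and \<open>k = 2 * n\<close>, and \<open>st\<close> takes the same value at these two \<open>k\<close>.
\<close>

lemma st_double: "st (2 * n) = st n"
  by (cases "n = 0") (simp_all add: st_even)

text \<open>
  The exact form of the telescoped recurrence: the term \<open>1\<close> is the starting value \<open>st 1\<close>, and the
  other boundary term \<open>st 0\<close> vanishes.
\<close>

lemma st_odd_eq_partial_sum: "st (2 * k + 1) = 1 + st k + 2 * (\<Sum>j<k. st j)"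
proof (induction k)
  case 0
  show ?case by (simp add: st_0 st_1[simplified])
next
  case (Suc k)
  have "st (2 * Suc k + 1) = st (2 * Suc k) + st (2 * k + 1) + st (2 * k)"
    using st_odd[of "Suc k"] by simp
  also have "\<dots> = st (Suc k) + st (2 * k + 1) + st k"
    by (simp only: st_double)
  finally show ?case
    using Suc.IH by simp
qed

theorem theorem4p5:
  fixes n :: nat
  shows "[st (2 * n + 1) + st (4 * n + 1) = 0] (mod 2)"
proof -
  have "st (4 * n + 1) = 1 + st n + 2 * (\<Sum>j<2 * n. st j)"
    using st_odd_eq_partial_sum[of "2 * n"] by (simp add: st_double)
  then have "st (2 * n + 1) + st (4 * n + 1) =
      2 * (1 + st n + (\<Sum>j<n. st j) + (\<Sum>j<2 * n. st j))"
    using st_odd_eq_partial_sum[of n] by simp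
  then show ?thesis
    by (simp only: cong_def mod_mult_self1_is_0 mod_0)
qed

end
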